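(* Let $(S_n)_{n\ge 0}$ be a transient random walk on a countable group $G$ started at the identity element $e$, and let $$\gamma = P(S_n\neq e,\ \forall n\ge 1)>0.$$ Suppose that $f:\mathbb{Z}_+\to\mathbb{R}$ with $f(0)=0$ satisfies $$\sum_{j=1}^\infty |f(j)|(1-\gamma)^j<\infty.$$ Then, as $n\to\infty$, $$\frac{1}{n}G_n(f)\to \gamma^2\sum_{j=1}^\infty f(j)(1-\gamma)^{j-1}$$ in $L^1$ and with probability $1$.
   Context: $G$ is a countable group (written multiplicatively) with identity $e$. The random walk is $S_0=e$ almost surely and $S_n=\xi_1\xi_2\cdots\xi_n$ for $n\ge 1$, where $(\xi_n)_{n\ge1}$ is a sequence of independent and identically distributed $G$-valued random variables. Transience means $P(S_n\ne e,\ \forall n\ge 1)>0$. $\mathbb{Z}_+=\{0,1,2,\dots\}$. The local time of $x\in G$ up to time $n\ge 0$ is $\ell(n,x)=\sum_{i=0}^{n}\mathbb{I}_{(S_i=x)}$, where $\mathbb{I}$ is the indicator. For $f:\mathbb{Z}_+\to\mathbb{R}$ with $f(0)=0$ and $n\ge 1$, $G_n(f)=\sum_{x\in G} f(\ell(n-1,x))$ (a sum with finitely many nonzero terms). Convention: $0^0=1$. *)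

theory Defs
  imports "HOL-Probability.Probability" "HOL-Algebra.Group"
begin

primrec oprod :: "('g, 'b) monoid_scheme \<Rightarrow> (nat \<Rightarrow> 'g) \<Rightarrow> nat \<Rightarrow> 'g" where
  "oprod G x 0 = \<one>\<^bsub>G\<^esub>"
| "oprod G x (Suc n) = oprod G x n \<otimes>\<^bsub>G\<^esub> x (Suc n)"

text \<open>
  The group is discrete, so its sigma-algebra is the one of all subsets of the carrier.
  The steps are indexed from 1; the value of \<open>\<xi> 0\<close> plays no role.
\<close>

locale random_walk = prob_space M + group G
  for M :: "'w measure" and G :: "('g, 'b) monoid_scheme"
    and \<xi> :: "nat \<Rightarrow> 'w \<Rightarrow> 'g" and S :: "nat \<Rightarrow> 'w \<Rightarrow> 'g" +
  assumes countable_carrier: "countable (carrier G)"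
    and indep_steps: "indep_vars (\<lambda>_. count_space (carrier G)) \<xi> {1..}"
    and ident_steps: "\<And>n. n \<ge> 1 \<Longrightarrow>
          distr M (count_space (carrier G)) (\<xi> n) = distr M (count_space (carrier G)) (\<xi> 1)"
    and walk_0_measurable: "random_variable (count_space (carrier G)) (S 0)"
    and walk_0: "AE \<omega> in M. S 0 \<omega> = \<one>\<^bsub>G\<^esub>"
    and walk: "\<And>n \<omega>. n \<ge> 1 \<Longrightarrow> \<omega> \<in> space M \<Longrightarrow> S n \<omega> = oprod G (\<lambda>i. \<xi> i \<omega>) n"

definition escape_prob ::
  "'w measure \<Rightarrow> ('g, 'b) monoid_scheme \<Rightarrow> (nat \<Rightarrow> 'w \<Rightarrow> 'g) \<Rightarrow> real" where
  "escape_prob M G S = measure M {\<omega> \<in> space M. \<forall>n\<ge>1. S n \<omega> \<noteq> \<one>\<^bsub>G\<^esub>}"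

definition transient ::
  "'w measure \<Rightarrow> ('g, 'b) monoid_scheme \<Rightarrow> (nat \<Rightarrow> 'w \<Rightarrow> 'g) \<Rightarrow> bool" where
  "transient M G S \<longleftrightarrow> escape_prob M G S > 0"

definition local_time :: "(nat \<Rightarrow> 'w \<Rightarrow> 'g) \<Rightarrow> nat \<Rightarrow> 'g \<Rightarrow> 'w \<Rightarrow> nat" where
  "local_time S n x \<omega> = (\<Sum>i=0..n. of_bool (S i \<omega> = x))"

text \<open>
  Meant for \<open>n \<ge> 1\<close> and \<open>f 0 = 0\<close>: then only the finitely many sites
  visited before time \<open>n\<close> contribute to the sum.
\<close>

definition local_time_sum ::
  "('g, 'b) monoid_scheme \<Rightarrow> (nat \<Rightarrow> 'w \<Rightarrow> 'g) \<Rightarrow> (nat \<Rightarrow> real) \<Rightarrow> nat \<Rightarrow> 'w \<Rightarrow> real" where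
  "local_time_sum G S f n \<omega> = (\<Sum>\<^sub>\<infinity>x\<in>carrier G. f (local_time S (n - 1) x \<omega>))"

end

theory Submission
  imports Defs "HOL-Real_Asymp.Real_Asymp"
begin

text \<open>
  Number the visits to a site backwards in time. If \<open>g j = f j - f (j - 1)\<close>, then \<open>f (\<ell>)\<close> is the
  telescoping sum of \<open>g\<close> over the ranks \<open>1, \<dots>, \<ell>\<close>, so the sum of \<open>f\<close> over all sites visited
  before time \<open>n\<close> equals the sum over \<open>i < n\<close> of \<open>g\<close> at the number of visits to \<open>S\<^sub>i\<close> in the time
  window from \<open>i\<close> to \<open>n - 1\<close> (\<open>local_time_sum_increments\<close>). If the window is extended to
  infinity, this number becomes the total number \<open>N\<close> of visits to the identity by the walk restarted
  at time \<open>i\<close>. It looks only forward in time, so the summands are the values of one function, \<open>g\<close> of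
  \<open>N\<close>, along the orbit of the step sequence under the shift, which is ergodic by Kolmogorov's 0-1 law
  (\<open>shift_seq_ergodic\<close>).

  The ergodic theorem (\<open>birkhoff_ergodic\<close>) makes the averages converge to the mean of \<open>g\<close> at \<open>N\<close>.
  Restarting at the successive returns shows that \<open>N\<close> is geometric: the probability of \<open>N > j\<close> is
  \<open>(1 - \<gamma>) ^ j\<close> (\<open>prob_visits_exceed\<close>). Summation by parts then turns the mean into
  \<open>\<gamma>\<^sup>2 * (\<Sum>j. f (Suc j) * (1 - \<gamma>) ^ j)\<close>.

  The windows that miss a late return cost little. Let \<open>h j\<close> be the sum of \<open>\<bar>g i\<bar>\<close> over \<open>i \<le> j\<close>; it is
  nondecreasing in \<open>j\<close> and satisfies the same summability condition as \<open>f\<close>. The error at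
  index \<open>i\<close> is at most \<open>2 * h N\<close>, evaluated for the restarted walk, and it occurs only if that walk
  returns at some time \<open>\<ge> n - i\<close>. By transience such functions decrease to \<open>0\<close> as \<open>n - i\<close>
  grows, which suffices for their averages to vanish (\<open>birkhoff_delayed_vanishing\<close>).

  Convergence in \<open>L\<^sup>1\<close> follows from almost sure convergence, because the averages are dominated
  by ergodic averages of \<open>h N\<close>, which converge and have constant expectation
  (\<open>L1_convergence_of_dominated\<close>).
\<close>

section \<open>The ergodic theorem\<close>

locale ergodic_map = prob_space M for M :: "'a measure" +
  fixes T :: "'a \<Rightarrow> 'a"
  assumes T_measurable [measurable]: "T \<in> M \<rightarrow>\<^sub>M M"
    and T_preserves: "distr M M T = M"
    and T_ergodic: "\<And>D. D \<in> sets M \<Longrightarrow> T -` D \<inter> space M = D \<Longrightarrow> prob D = 0 \<or> prob D = 1"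

definition birkhoff_sum :: "('a \<Rightarrow> 'a) \<Rightarrow> ('a \<Rightarrow> real) \<Rightarrow> nat \<Rightarrow> 'a \<Rightarrow> real" where
  "birkhoff_sum T f n x = (\<Sum>i<n. f ((T ^^ i) x))"

lemma birkhoff_sum_0 [simp]: "birkhoff_sum T f 0 x = 0"
  by (simp add: birkhoff_sum_def)

lemma birkhoff_sum_Suc: "birkhoff_sum T f (Suc n) x = f x + birkhoff_sum T f n (T x)"
  by (simp add: birkhoff_sum_def sum.lessThan_Suc_shift funpow_swap1 del: sum.lessThan_Suc)

text \<open>
  The maximum of the Birkhoff sums of length \<open>0\<close> to \<open>n\<close>, defined by the recursion that the
  maximal ergodic theorem exploits.
\<close>

primrec birkhoff_max :: "('a \<Rightarrow> 'a) \<Rightarrow> ('a \<Rightarrow> real) \<Rightarrow> nat \<Rightarrow> 'a \<Rightarrow> real" where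
  "birkhoff_max T f 0 x = 0"
| "birkhoff_max T f (Suc n) x = max 0 (f x + birkhoff_max T f n (T x))"

lemma birkhoff_max_mono: "birkhoff_max T f n x \<le> birkhoff_max T f (Suc n) x"
proof (induction n arbitrary: x)
  case (Suc n)
  show ?case using Suc[of "T x"] by (simp only: birkhoff_max.simps)
qed simp

lemma birkhoff_max_nonneg: "0 \<le> birkhoff_max T f n x"
  by (cases n) auto

lemma birkhoff_sum_le_max: "birkhoff_sum T f n x \<le> birkhoff_max T f n x"
proof (induction n arbitrary: x)
  case (Suc n)
  show ?case using Suc[of "T x"] by (simp add: birkhoff_sum_Suc)
qed simp

context ergodic_map
begin

lemma funpow_measurable [measurable]: "T ^^ i \<in> M \<rightarrow>\<^sub>M M"
  by (rule measurable_compose_n[OF T_measurable])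

lemma birkhoff_sum_measurable [measurable]:
  "f \<in> borel_measurable M \<Longrightarrow> birkhoff_sum T f n \<in> borel_measurable M"
  unfolding birkhoff_sum_def[abs_def]
  by (intro borel_measurable_sum measurable_compose[OF funpow_measurable])

lemma birkhoff_max_measurable [measurable]:
  assumes [measurable]: "f \<in> borel_measurable M"
  shows "birkhoff_max T f n \<in> borel_measurable M"
  by (induction n) (simp_all del: fun_upd_apply)

lemma integrable_comp: 
  fixes f :: "'a \<Rightarrow> real"
  assumes "integrable M f" shows "integrable M (\<lambda>x. f (T x))"
  using integrable_distr[OF T_measurable, of f] assms by (simp add: T_preserves)

lemma integral_comp: 
  fixes f :: "'a \<Rightarrow> real"
  assumes [measurable]: "f \<in> borel_measurable M" shows "(\<integral>x. f (T x) \<partial>M) = (\<integral>x. f x \<partial>M)"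
  using integral_distr[OF T_measurable, of f] by (simp add: T_preserves)

lemma AE_comp:
  assumes "AE x in M. P x" shows "AE x in M. P (T x)"
proof -
  have "AE x in distr M M T. P x" unfolding T_preserves by (rule assms)
  then show ?thesis by (rule AE_distrD[OF T_measurable])
qed

lemma AE_orbit:
  assumes "AE x in M. P x" shows "AE x in M. \<forall>i. P ((T ^^ i) x)"
proof -
  have "AE x in M. P ((T ^^ i) x)" for i
  proof (induction i)
    case (Suc i)
    show ?case using AE_comp[OF Suc] by (simp add: funpow_swap1)
  qed (use assms in simp)
  then show ?thesis by (simp add: AE_all_countable)
qed

lemma funpow_space: "x \<in> space M \<Longrightarrow> (T ^^ i) x \<in> space M"
  by (rule measurable_space[OF funpow_measurable])

lemma integrable_birkhoff_sum:
  assumes "integrable M f" shows "integrable M (birkhoff_sum T f n)"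
    and "(\<integral>x. birkhoff_sum T f n x \<partial>M) = n * (\<integral>x. f x \<partial>M)"
proof -
  have *: "integrable M (birkhoff_sum T f n) \<and> (\<integral>x. birkhoff_sum T f n x \<partial>M) = n * (\<integral>x. f x \<partial>M)"
  proof (induction n)
    case 0
    show ?case by (simp add: birkhoff_sum_def[abs_def])
  next
    case (Suc n)
    have "birkhoff_sum T f (Suc n) = (\<lambda>x. f x + birkhoff_sum T f n (T x))"
      by (auto simp: birkhoff_sum_Suc)
    then show ?case
      using Suc assms integrable_comp[of "birkhoff_sum T f n"] integral_comp[of "birkhoff_sum T f n"]
      by (auto simp: algebra_simps)
  qed
  then show "integrable M (birkhoff_sum T f n)"
    and "(\<integral>x. birkhoff_sum T f n x \<partial>M) = n * (\<integral>x. f x \<partial>M)" by auto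
qed

lemma integrable_birkhoff_max:
  assumes "integrable M f" shows "integrable M (birkhoff_max T f n)"
proof (induction n)
  case (Suc n)
  show ?case
    using integrable_max[OF _ Bochner_Integration.integrable_add[OF assms integrable_comp[OF Suc]], of "\<lambda>_. 0"]
    by simp
qed simp

text \<open>
  Garsia's argument. Where the running maximum \<open>m\<close> is positive, the recursion bounds \<open>f\<close>
  below by \<open>m - m \<circ> T\<close>; elsewhere this difference is at most \<open>0\<close>. It has integral \<open>0\<close> because \<open>T\<close>
  preserves the measure, so \<open>f\<close> has a nonnegative integral over the set where \<open>m > 0\<close>, and these
  sets exhaust the space.
\<close>

theorem maximal_ergodic:
  assumes f: "integrable M f" and pos: "AE x in M. \<exists>n. birkhoff_sum T f n x > 0"
  shows "0 \<le> (\<integral>x. f x \<partial>M)"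
proof -
  have [measurable]: "f \<in> borel_measurable M" using f by auto
  define E where "E n x = indicator {x. birkhoff_max T f n x > 0} x * f x" for n x
  have Em [measurable]: "E n \<in> borel_measurable M" for n
    unfolding E_def[abs_def] by measurable
  have E_int: "integrable M (E n)" for n
    by (rule Bochner_Integration.integrable_bound[OF f]) (auto simp: E_def indicator_def)
  have E_nonneg: "0 \<le> (\<integral>x. E n x \<partial>M)" for n
  proof -
    let ?m = "birkhoff_max T f n"
    have m: "integrable M ?m" by (rule integrable_birkhoff_max[OF f])
    have le: "?m x - ?m (T x) \<le> E n x" for x
    proof (cases "?m x > 0")
      case True
      then show ?thesis using birkhoff_max_mono[of T f n x] by (auto simp: E_def max_def split: if_splits)
    next
      case False
      then show ?thesis using birkhoff_max_nonneg[of T f n "T x"] by (simp add: E_def)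
    qed
    have "0 = (\<integral>x. ?m x - ?m (T x) \<partial>M)"
      using m integrable_comp[OF m] integral_comp[of ?m] by simp
    also have "\<dots> \<le> (\<integral>x. E n x \<partial>M)"
      by (rule integral_mono) (use m integrable_comp[OF m] E_int le in auto)
    finally show ?thesis .
  qed
  have "(\<lambda>n. \<integral>x. E n x \<partial>M) \<longlonglongrightarrow> (\<integral>x. f x \<partial>M)"
  proof (rule integral_dominated_convergence[where w = "\<lambda>x. \<bar>f x\<bar>"])
    show "AE x in M. (\<lambda>n. E n x) \<longlonglongrightarrow> f x"
      using pos
    proof eventually_elim
      case (elim x)
      then obtain k where k: "birkhoff_max T f k x > 0"
        using birkhoff_sum_le_max[of T f _ x] by (meson less_le_trans)
      have "\<forall>n\<ge>k. birkhoff_max T f n x > 0"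
        using k lift_Suc_mono_le[of "\<lambda>n. birkhoff_max T f n x", OF birkhoff_max_mono]
        by (meson less_le_trans)
      then have "eventually (\<lambda>n. E n x = f x) sequentially"
        by (auto simp: E_def indicator_def eventually_sequentially intro!: exI[of _ k])
      then show ?case by (rule tendsto_eventually)
    qed
  qed (use f in \<open>auto simp: E_def indicator_def\<close>)
  then show ?thesis
    by (rule LIMSEQ_le_const) (use E_nonneg in auto)
qed

text \<open>
  Boundedness of the Birkhoff sums is an invariant event, so by ergodicity it has probability \<open>0\<close>
  or \<open>1\<close>. If the sums were almost surely unbounded, they would become positive and the maximal theorem
  would contradict the negative mean.
\<close>

lemma birkhoff_sum_bounded_above:
  assumes f: "integrable M f" and neg: "(\<integral>x. f x \<partial>M) < 0"
  shows "AE x in M. \<exists>B. \<forall>n. birkhoff_sum T f n x \<le> B"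
proof -
  have [measurable]: "f \<in> borel_measurable M" using f by auto
  define bdd where "bdd x \<longleftrightarrow> (\<exists>B::nat. \<forall>n. birkhoff_sum T f n x \<le> real B)" for x
  define D where "D = {x \<in> space M. bdd x}"
  have D [measurable]: "D \<in> sets M" unfolding D_def bdd_def by measurable
  have shift: "bdd (T x) \<longleftrightarrow> bdd x" for x
  proof
    assume "bdd (T x)"
    then obtain B :: nat where B: "birkhoff_sum T f n (T x) \<le> real B" for n unfolding bdd_def by blast
    have "birkhoff_sum T f n x \<le> real (B + nat \<lceil>\<bar>f x\<bar>\<rceil>)" for n
    proof (cases n)
      case (Suc k)
      then show ?thesis using B[of k] by (simp add: birkhoff_sum_Suc) linarith
    qed simp
    then show "bdd x" unfolding bdd_def by blast
  next
    assume "bdd x"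
    then obtain B :: nat where B: "birkhoff_sum T f n x \<le> real B" for n unfolding bdd_def by blast
    have "birkhoff_sum T f n (T x) \<le> real (B + nat \<lceil>\<bar>f x\<bar>\<rceil>)" for n
      using B[of "Suc n"] by (simp add: birkhoff_sum_Suc) linarith
    then show "bdd (T x)" unfolding bdd_def by blast
  qed
  have "T -` D \<inter> space M = D"
    unfolding D_def using measurable_space[OF T_measurable] by (auto simp: shift)
  then consider "prob D = 0" | "prob D = 1" using T_ergodic[OF D] by blast
  then have "AE x in M. bdd x"
  proof cases
    case 1
    then have "AE x in M. x \<notin> D" by (intro AE_not_in) (simp add: null_sets_def emeasure_eq_measure)
    then have "AE x in M. \<exists>n. birkhoff_sum T f n x > 0"
    proof (rule AE_mp, intro AE_I2 impI)
      fix x assume x: "x \<in> space M" "x \<notin> D"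
      then have "\<not> bdd x" by (simp add: D_def)
      then have "\<not> (\<forall>n. birkhoff_sum T f n x \<le> real 0)" unfolding bdd_def by blast
      then show "\<exists>n. birkhoff_sum T f n x > 0" by (auto simp: not_le)
    qed
    from maximal_ergodic[OF f this] neg show ?thesis by simp
  next
    case 2
    then have "AE x in M. x \<in> D" by (simp add: prob_eq_1)
    then show ?thesis by (auto simp: D_def elim: eventually_mono)
  qed
  then show ?thesis by (auto simp: bdd_def elim!: eventually_mono)
qed

lemma birkhoff_average_upper:
  assumes f: "integrable M f" and e: "e > 0"
  shows "AE x in M. \<forall>\<^sub>F n in sequentially. birkhoff_sum T f n x / n < (\<integral>x. f x \<partial>M) + e"
proof -
  let ?c = "\<integral>x. f x \<partial>M"
  define g where "g x = f x - (?c + e / 2)" for x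
  have g: "integrable M g" "(\<integral>x. g x \<partial>M) = - e / 2"
    using f by (auto simp: g_def[abs_def] prob_space)
  have g_sum: "birkhoff_sum T g n x = birkhoff_sum T f n x - n * (?c + e / 2)" for n x
    by (simp add: birkhoff_sum_def g_def sum_subtractf)
  have "AE x in M. \<exists>B. \<forall>n. birkhoff_sum T g n x \<le> B"
    by (rule birkhoff_sum_bounded_above) (use g e in auto)
  then show ?thesis
  proof eventually_elim
    case (elim x)
    then obtain B where B: "birkhoff_sum T f n x \<le> B + n * (?c + e / 2)" for n
      unfolding g_sum by (auto simp: algebra_simps)
    have "(\<lambda>n. B / real n) \<longlonglongrightarrow> 0" by (rule lim_const_over_n)
    then have "\<forall>\<^sub>F n in sequentially. B / real n < e / 2"
      by (rule order_tendstoD) (use e in simp)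
    then show ?case using eventually_gt_at_top[of 0]
    proof eventually_elim
      case (elim n)
      have "birkhoff_sum T f n x / n \<le> (B + n * (?c + e / 2)) / n"
        by (rule divide_right_mono[OF B]) simp
      also have "\<dots> = B / n + (?c + e / 2)" using elim by (simp add: field_simps)
      finally show ?case using elim by linarith
    qed
  qed
qed

theorem birkhoff_ergodic:
  assumes f: "integrable M f"
  shows "AE x in M. (\<lambda>n. birkhoff_sum T f n x / n) \<longlonglongrightarrow> (\<integral>x. f x \<partial>M)"
proof -
  let ?c = "\<integral>x. f x \<partial>M"
  have up: "AE x in M. \<forall>k. \<forall>\<^sub>F n in sequentially. birkhoff_sum T f n x / n < ?c + 1 / real (Suc k)"
    by (subst AE_all_countable, intro allI birkhoff_average_upper f) simp
  have "AE x in M. \<forall>k. \<forall>\<^sub>F n in sequentially.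
      birkhoff_sum T (\<lambda>x. - f x) n x / n < (\<integral>x. - f x \<partial>M) + 1 / real (Suc k)"
    by (subst AE_all_countable, intro allI birkhoff_average_upper) (use f in auto)
  then have "AE x in M. \<forall>k. \<forall>\<^sub>F n in sequentially. ?c - 1 / real (Suc k) < birkhoff_sum T f n x / n"
    by (simp add: birkhoff_sum_def sum_negf algebra_simps)
  with up show ?thesis
  proof eventually_elim
    case (elim x)
    show ?case
    proof (rule LIMSEQ_I)
      fix r :: real assume "0 < r"
      then obtain k where k: "1 / real (Suc k) < r" using nat_approx_posE by (metis of_nat_Suc)
      have "\<forall>\<^sub>F n in sequentially. norm (birkhoff_sum T f n x / n - ?c) < r"
        using elim(1)[rule_format, of k] elim(2)[rule_format, of k]
        by eventually_elim (use k in \<open>simp add: abs_less_iff\<close>)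
      then show "\<exists>no. \<forall>n\<ge>no. norm (birkhoff_sum T f n x / n - ?c) < r"
        by (simp add: eventually_sequentially)
    qed
  qed
qed

text \<open>
  Averages along an orbit of functions that depend on the time \<open>n - i\<close> still to come. For each fixed
  \<open>m\<close>, all but the last \<open>m\<close> terms are at most \<open>u m\<close>, whose averages tend to its mean, and this mean is small
  for large \<open>m\<close>. The last \<open>m\<close> terms are at most \<open>u 0\<close>; their share is the difference of two
  averages of \<open>u 0\<close> with the same limit.
\<close>

lemma birkhoff_delayed_vanishing:
  assumes u0: "integrable M (u 0)" and u_meas [measurable]: "\<And>m. u m \<in> borel_measurable M"
    and u_nonneg: "\<And>m x. 0 \<le> u m x" and u_dec: "\<And>x. decseq (\<lambda>m. u m x)"
    and u_lim: "AE x in M. (\<lambda>m. u m x) \<longlonglongrightarrow> (0::real)"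
  shows "AE x in M. (\<lambda>n. (\<Sum>i<n. u (n - i) ((T ^^ i) x)) / n) \<longlonglongrightarrow> 0"
proof -
  have u_le: "u m x \<le> u k x" if "k \<le> m" for m k x using u_dec that by (auto simp: decseq_def)
  have u_int: "integrable M (u m)" for m
    by (rule Bochner_Integration.integrable_bound[OF u0]) (use u_nonneg u_le in auto)
  have u_mean: "(\<lambda>m. \<integral>x. u m x \<partial>M) \<longlonglongrightarrow> (\<integral>x. 0 \<partial>M)"
    by (rule integral_dominated_convergence[where w = "u 0"]) (use u0 u_lim u_nonneg u_le in auto)
  have "AE x in M. \<forall>m. (\<lambda>n. birkhoff_sum T (u m) n x / n) \<longlonglongrightarrow> (\<integral>x. u m x \<partial>M)"
    by (simp add: AE_all_countable birkhoff_ergodic u_int)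
  then show ?thesis
  proof eventually_elim
    case (elim x)
    let ?E = "\<lambda>n. (\<Sum>i<n. u (n - i) ((T ^^ i) x))"
    let ?A = "\<lambda>m n. birkhoff_sum T (u m) n x"
    have bound: "?E n \<le> ?A m n + (?A 0 n - ?A 0 (n - m))" for m n
    proof -
      have "?E n = (\<Sum>i<n - m. u (n - i) ((T ^^ i) x)) + (\<Sum>i\<in>{n-m..<n}. u (n - i) ((T ^^ i) x))"
        using sum.atLeastLessThan_concat[of 0 "n - m" n "\<lambda>i. u (n - i) ((T ^^ i) x)"] by (simp add: atLeast0LessThan)
      also have "\<dots> \<le> (\<Sum>i<n - m. u m ((T ^^ i) x)) + (\<Sum>i\<in>{n-m..<n}. u 0 ((T ^^ i) x))"
        by (intro add_mono sum_mono u_le) auto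
      also have "(\<Sum>i<n - m. u m ((T ^^ i) x)) \<le> ?A m n"
        unfolding birkhoff_sum_def by (rule sum_mono2) (use u_nonneg in auto)
      also have "(\<Sum>i\<in>{n-m..<n}. u 0 ((T ^^ i) x)) = ?A 0 n - ?A 0 (n - m)"
        using sum.atLeastLessThan_concat[of 0 "n - m" n "\<lambda>i. u 0 ((T ^^ i) x)"]
        by (simp add: atLeast0LessThan birkhoff_sum_def)
      finally show ?thesis by simp
    qed
    have lim: "(\<lambda>n. (?A m n + (?A 0 n - ?A 0 (n - m))) / n) \<longlonglongrightarrow> (\<integral>x. u m x \<partial>M)" for m
    proof -
      have a: "(\<lambda>n. ?A 0 (n - m) / real (n - m)) \<longlonglongrightarrow> (\<integral>x. u 0 x \<partial>M)"
        using filterlim_compose[OF elim[rule_format, of 0] filterlim_minus_const_nat_at_top] .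
      have b: "(\<lambda>n. real (n - m) / real n) \<longlonglongrightarrow> 1" by real_asymp
      have "(\<lambda>n. (?A 0 (n - m) / real (n - m)) * (real (n - m) / real n)) \<longlonglongrightarrow> (\<integral>x. u 0 x \<partial>M)"
        using tendsto_mult[OF a b] by simp
      moreover have "\<forall>\<^sub>F n in sequentially.
          (?A 0 (n - m) / real (n - m)) * (real (n - m) / real n) = ?A 0 (n - m) / real n"
        using eventually_gt_at_top[of m] by eventually_elim simp
      ultimately have "(\<lambda>n. ?A 0 (n - m) / real n) \<longlonglongrightarrow> (\<integral>x. u 0 x \<partial>M)"
        by (rule Lim_transform_eventually)
      from tendsto_add[OF elim[rule_format, of m] tendsto_diff[OF elim[rule_format, of 0] this]]
      show ?thesis by (simp add: add_divide_distrib diff_divide_distrib)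
    qed
    show ?case
    proof (rule LIMSEQ_I)
      fix r :: real assume "0 < r"
      then obtain m where m: "(\<integral>x. u m x \<partial>M) < r"
        using order_tendstoD(2)[OF u_mean, of r] by (auto simp: eventually_sequentially)
      have "\<forall>\<^sub>F n in sequentially. norm (?E n / n - 0) < r"
        using order_tendstoD(2)[OF lim m]
      proof eventually_elim
        case (elim n)
        have "?E n / n \<le> (?A m n + (?A 0 n - ?A 0 (n - m))) / n"
          by (rule divide_right_mono[OF bound]) simp
        moreover have "0 \<le> ?E n / n" by (simp add: sum_nonneg u_nonneg)
        ultimately show ?case using elim by simp
      qed
      then show "\<exists>no. \<forall>n\<ge>no. norm (?E n / n - 0) < r" by (simp add: eventually_sequentially)
    qed
  qed
qed

lemma prob_funpow_vimage:
  assumes D: "D \<in> sets M" shows "prob ((T ^^ k) -` D \<inter> space M) = prob D"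
proof (induction k)
  case (Suc k)
  let ?D = "(T ^^ k) -` D \<inter> space M"
  have eq: "(T ^^ Suc k) -` D \<inter> space M = T -` ?D \<inter> space M"
    using measurable_space[OF T_measurable] by (auto simp: funpow_swap1)
  have "?D \<in> sets M" by (rule measurable_sets[OF funpow_measurable D])
  then have "prob (T -` ?D \<inter> space M) = prob ?D"
    using measure_distr[OF T_measurable, of ?D] unfolding T_preserves by simp
  then show ?case using Suc unfolding eq by (rule trans)
qed (use sets.sets_into_space[OF D] in \<open>simp add: Int_absorb2\<close>)

text \<open>
  Dominated convergence with a varying bound \<open>W\<close>. Since \<open>W\<close> converges almost surely and has constant
  expectation, Scheffe's lemma applies to \<open>F = W - \<bar>Z\<bar>\<close>, and the expectation of \<open>\<bar>Z\<bar>\<close> is the amount by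
  which that of \<open>F\<close> falls short of the limit.
\<close>

lemma L1_convergence_of_dominated:
  fixes Z :: "nat \<Rightarrow> 'a \<Rightarrow> real"
  assumes h: "integrable M h" and Z_meas [measurable]: "\<And>n. Z n \<in> borel_measurable M"
    and dom: "\<And>n. n \<ge> 1 \<Longrightarrow> AE x in M. \<bar>Z n x\<bar> \<le> birkhoff_sum T h n x / n"
    and Z_lim: "AE x in M. (\<lambda>n. Z n x) \<longlonglongrightarrow> 0"
  shows "(\<lambda>n. \<integral>x. \<bar>Z n x\<bar> \<partial>M) \<longlonglongrightarrow> 0"
proof -
  let ?c = "\<integral>x. h x \<partial>M"
  \<comment> \<open>the index is moved up by one, since the bound says nothing about \<open>n = 0\<close>\<close>
  define W where "W n x = birkhoff_sum T h (Suc n) x / real (Suc n)" for n x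
  define F where "F n x = W n x - \<bar>Z (Suc n) x\<bar>" for n x
  have W_int: "integrable M (W n)" "(\<integral>x. W n x \<partial>M) = ?c" for n
    using integrable_birkhoff_sum[OF h, of "Suc n"] by (auto simp: W_def[abs_def] simp del: of_nat_Suc)
  have ZW: "AE x in M. \<bar>Z (Suc n) x\<bar> \<le> W n x" for n
    using dom[of "Suc n"] by (simp add: W_def)
  have Z_int: "integrable M (\<lambda>x. \<bar>Z (Suc n) x\<bar>)" for n
    by (rule Bochner_Integration.integrable_bound[OF W_int(1)[of n]]) (use ZW[of n] in \<open>auto elim!: eventually_mono\<close>)
  have F_int: "integrable M (F n)" for n unfolding F_def[abs_def] using W_int Z_int by simp
  have F_nonneg: "AE x in M. 0 \<le> F n x" for n using ZW[of n] by (simp add: F_def)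
  have F_le: "(\<integral>x. F n x \<partial>M) \<le> ?c" for n
  proof -
    have "(\<integral>x. F n x \<partial>M) \<le> (\<integral>x. W n x \<partial>M)"
      by (rule integral_mono[OF F_int W_int(1)]) (simp add: F_def)
    then show ?thesis by (simp add: W_int)
  qed
  have "0 \<le> (\<integral>x. F 0 x \<partial>M)" by (rule integral_nonneg_AE) (rule F_nonneg)
  then have c: "0 \<le> ?c" using F_le[of 0] by (rule order_trans)
  have "(\<lambda>n. \<integral>\<^sup>+x. norm (F n x - ?c) \<partial>M) \<longlonglongrightarrow> 0"
  proof (rule Scheffe_lemma1)
    show "AE x in M. (\<lambda>n. F n x) \<longlonglongrightarrow> ?c"
      using birkhoff_ergodic[OF h] Z_lim
    proof eventually_elim
      case (elim x)
      from tendsto_diff[OF elim(1) tendsto_rabs[OF elim(2)]]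
      have "(\<lambda>n. birkhoff_sum T h n x / real n - \<bar>Z n x\<bar>) \<longlonglongrightarrow> ?c" by simp
      from LIMSEQ_Suc[OF this] show ?case by (simp add: F_def W_def)
    qed
    have "(\<integral>\<^sup>+x. norm (F n x) \<partial>M) \<le> ennreal ?c" for n
    proof -
      have "(\<integral>\<^sup>+x. norm (F n x) \<partial>M) = (\<integral>\<^sup>+x. ennreal (F n x) \<partial>M)"
        by (rule nn_integral_cong_AE) (use F_nonneg[of n] in \<open>auto elim!: eventually_mono\<close>)
      then show ?thesis
        by (simp add: nn_integral_eq_integral[OF F_int F_nonneg] F_le ennreal_leI)
    qed
    then show "limsup (\<lambda>n. \<integral>\<^sup>+x. norm (F n x) \<partial>M) \<le> (\<integral>\<^sup>+x. norm ?c \<partial>M)"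
      using c by (intro Limsup_bounded) (auto simp: emeasure_space_1)
  qed (use F_int in auto)
  then have "(\<lambda>n. ennreal (\<integral>x. \<bar>F n x - ?c\<bar> \<partial>M)) \<longlonglongrightarrow> ennreal 0"
    by (subst (asm) nn_integral_eq_integral) (use F_int in auto)
  then have abs: "(\<lambda>n. \<integral>x. \<bar>F n x - ?c\<bar> \<partial>M) \<longlonglongrightarrow> 0"
    by (subst (asm) tendsto_ennreal_iff) auto
  have "(\<lambda>n. \<integral>x. \<bar>Z (Suc n) x\<bar> \<partial>M) \<longlonglongrightarrow> 0"
  proof (rule tendsto_sandwich[OF _ _ tendsto_const abs])
    have "(\<integral>x. \<bar>Z (Suc n) x\<bar> \<partial>M) = - (\<integral>x. F n x - ?c \<partial>M)" for n
      using W_int Z_int F_int by (simp add: F_def[abs_def] prob_space)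
    also have "\<dots> n \<le> (\<integral>x. \<bar>F n x - ?c\<bar> \<partial>M)" for n
      using integral_abs_bound[of M "\<lambda>x. F n x - ?c"] by linarith
    finally show "\<forall>\<^sub>F n in sequentially. (\<integral>x. \<bar>Z (Suc n) x\<bar> \<partial>M) \<le> (\<integral>x. \<bar>F n x - ?c\<bar> \<partial>M)" by simp
  qed simp
  then show ?thesis by (rule LIMSEQ_imp_Suc)
qed

end

section \<open>Shifts of independent sequences\<close>

definition shift_seq :: "(nat \<Rightarrow> 'a) \<Rightarrow> nat \<Rightarrow> 'a" where
  "shift_seq x = (\<lambda>i. x (Suc i))"

lemma shift_seq_funpow: "(shift_seq ^^ k) x = (\<lambda>i. x (k + i))"
  by (induction k arbitrary: x) (simp_all add: funpow_swap1 shift_seq_def)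

context prob_space
begin

abbreviation iid_sequences :: "(nat \<Rightarrow> 'a) measure" where
  "iid_sequences \<equiv> Pi\<^sub>M UNIV (\<lambda>_. M)"

lemma iid_prob_space: "prob_space iid_sequences"
  by (rule prob_space_PiM) (rule prob_space_axioms)

lemma indep_coordinates: "prob_space.indep_vars iid_sequences (\<lambda>_. M) (\<lambda>i x. x i) UNIV"
proof -
  interpret P: prob_space iid_sequences by (rule iid_prob_space)
  have *: "distr iid_sequences M (\<lambda>x. x i) = M" for i
    using distr_PiM_component[of UNIV "\<lambda>_. M" i] prob_space_axioms by simp
  show ?thesis
    by (subst P.indep_vars_iff_distr_eq_PiM) (auto simp: * restrict_def distr_id)
qed

lemma shift_seq_measurable: "shift_seq \<in> iid_sequences \<rightarrow>\<^sub>M iid_sequences"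
  unfolding shift_seq_def[abs_def] by (rule measurable_PiM_single') (auto simp: space_PiM)

text \<open>
  An event that is invariant under the shift is invariant under each of its powers, so it does not
  depend on the first \<open>k\<close> coordinates, for any \<open>k\<close>: it is a tail event of independent coordinates.
\<close>

theorem shift_seq_ergodic: "ergodic_map iid_sequences shift_seq"
proof -
  interpret P: prob_space iid_sequences by (rule iid_prob_space)
  show ?thesis
  proof
    show "shift_seq \<in> iid_sequences \<rightarrow>\<^sub>M iid_sequences" by (rule shift_seq_measurable)
    show "distr iid_sequences iid_sequences shift_seq = iid_sequences"
      using distr_PiM_reindex[of UNIV "\<lambda>_. M" Suc UNIV] prob_space_axioms
      by (simp add: shift_seq_def[abs_def] restrict_def)
  next
    fix D assume D: "D \<in> sets iid_sequences" and inv: "shift_seq -` D \<inter> space iid_sequences = D"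
    define A where
      "A i = sigma_sets (space iid_sequences) {(\<lambda>x. x i) -` B \<inter> space iid_sequences | B. B \<in> sets M}"
      for i :: nat
    have inv_k: "(shift_seq ^^ k) -` D \<inter> space iid_sequences = D" for k
    proof (induction k)
      case 0
      then show ?case using sets.sets_into_space[OF D] by auto
    next
      case (Suc k)
      have "(shift_seq ^^ Suc k) -` D \<inter> space iid_sequences
          = shift_seq -` ((shift_seq ^^ k) -` D \<inter> space iid_sequences) \<inter> space iid_sequences"
        using measurable_space[OF shift_seq_measurable] by (auto simp: funpow_swap1)
      then show ?case unfolding Suc inv .
    qed
    have "D \<in> sigma_sets (space iid_sequences) (\<Union> (A ` {k..}))" for k
    proof -
      define N where "N = sigma (space iid_sequences) (\<Union> (A ` {k..}))"
      have "A i \<subseteq> Pow (space iid_sequences)" for i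
        unfolding A_def by (rule subsetI, drule sigma_sets_into_sp[rotated]) auto
      then have N: "space N = space iid_sequences"
          "sets N = sigma_sets (space iid_sequences) (\<Union> (A ` {k..}))"
        unfolding N_def by (auto simp: space_measure_of_conv intro!: sets_measure_of)
      have coord: "(\<lambda>x. x (k + i)) \<in> N \<rightarrow>\<^sub>M M" for i
      proof (rule measurableI)
        fix B assume "B \<in> sets M"
        then have "(\<lambda>x. x (k + i)) -` B \<inter> space N \<in> A (k + i)"
          unfolding A_def N by (intro sigma_sets.Basic) auto
        then show "(\<lambda>x. x (k + i)) -` B \<inter> space N \<in> sets N"
          unfolding N(2) by (intro sigma_sets.Basic) auto
      qed (auto simp: N space_PiM)
      have "shift_seq ^^ k \<in> N \<rightarrow>\<^sub>M iid_sequences"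
        unfolding shift_seq_funpow[abs_def]
        by (rule measurable_PiM_single'[OF coord]) (auto simp: N space_PiM)
      from measurable_sets[OF this D] show ?thesis by (simp add: N inv_k)
    qed
    then have "D \<in> P.tail_events A" by (simp add: P.tail_events_def)
    moreover have "P.indep_sets A UNIV"
      using indep_coordinates unfolding P.indep_vars_def A_def by simp
    moreover have "sigma_algebra (space iid_sequences) (A i)" for i
      unfolding A_def by (rule sigma_algebra_sigma_sets) auto
    ultimately show "P.prob D = 0 \<or> P.prob D = 1" by (intro P.kolmogorov_0_1_law)
  qed
qed

lemma indep_past_future:
  assumes A: "A \<in> sets (Pi\<^sub>M {..<k} (\<lambda>_. M))" and B: "B \<in> sets iid_sequences"
  shows "measure iid_sequences {x \<in> space iid_sequences. restrict x {..<k} \<in> A \<and> (shift_seq ^^ k) x \<in> B}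
    = measure iid_sequences {x \<in> space iid_sequences. restrict x {..<k} \<in> A} * measure iid_sequences B"
proof -
  interpret P: prob_space iid_sequences by (rule iid_prob_space)
  interpret E: ergodic_map iid_sequences shift_seq by (rule shift_seq_ergodic)
  have shift_B: "(\<lambda>x i. x (k + i)) \<in> Pi\<^sub>M {k..} (\<lambda>_. M) \<rightarrow>\<^sub>M iid_sequences"
    by (rule measurable_PiM_single') (auto simp: space_PiM)
  have "P.indep_var (Pi\<^sub>M {..<k} (\<lambda>_. M)) (\<lambda>x. restrict x {..<k}) (Pi\<^sub>M {k..} (\<lambda>_. M)) (\<lambda>x. restrict x {k..})"
    by (rule P.indep_var_restrict[OF indep_coordinates]) auto
  from P.indep_var_compose[OF this measurable_ident shift_B]
  have "P.indep_var (Pi\<^sub>M {..<k} (\<lambda>_. M)) (\<lambda>x. restrict x {..<k}) iid_sequences (shift_seq ^^ k)"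
    by (simp add: comp_def shift_seq_funpow[abs_def])
  from P.indep_varD[OF this A B] show ?thesis
    using E.prob_funpow_vimage[OF B, of k] by (simp add: vimage_def Int_def conj_commute)
qed

end

section \<open>Returns of a random walk to the identity\<close>

text \<open>
  The walk as a function of its step sequence. Sequences are indexed from \<open>0\<close>, so that the shift acts
  on them, whereas \<open>oprod\<close> reads the steps from index \<open>1\<close> on.
\<close>

definition walk_at :: "('g, 'b) monoid_scheme \<Rightarrow> (nat \<Rightarrow> 'g) \<Rightarrow> nat \<Rightarrow> 'g" where
  "walk_at G x n = oprod G (\<lambda>i. x (i - 1)) n"

lemma walk_at_0 [simp]: "walk_at G x 0 = \<one>\<^bsub>G\<^esub>"
  and walk_at_Suc: "walk_at G x (Suc n) = walk_at G x n \<otimes>\<^bsub>G\<^esub> x n"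
  by (simp_all add: walk_at_def)

definition returns :: "('g, 'b) monoid_scheme \<Rightarrow> (nat \<Rightarrow> 'g) \<Rightarrow> nat set" where
  "returns G x = {n. walk_at G x n = \<one>\<^bsub>G\<^esub>}"

lemma zero_in_returns [simp]: "0 \<in> returns G x" by (simp add: returns_def)

lemma card_ge_after_shift:
  assumes "A = insert (0::nat) ((+) k ` B)" "k \<ge> 1"
  shows "(infinite A \<or> Suc j < card A) \<longleftrightarrow> (infinite B \<or> j < card B)"
proof (cases "finite B")
  case True
  have "0 \<notin> (+) k ` B" using assms(2) by auto
  then have "card A = Suc (card B)" using True by (simp add: assms(1) card_image)
  then show ?thesis using True by (simp add: assms(1))
next
  case False
  then show ?thesis by (simp add: assms(1) finite_image_iff)
qed

locale walk_law = prob_space M + group G for M :: "'g measure" and G :: "('g, 'b) monoid_scheme" (structure) +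
  assumes countable_carrier: "countable (carrier G)" and sets_law: "sets M = Pow (carrier G)"
begin

lemma space_law: "space M = carrier G"
  using sets_eq_imp_space_eq[of M "count_space (carrier G)"] sets_law by simp

sublocale walk: ergodic_map iid_sequences shift_seq by (rule shift_seq_ergodic)

lemma iid_space: "x \<in> space iid_sequences \<longleftrightarrow> (\<forall>i. x i \<in> carrier G)"
  by (auto simp: space_PiM space_law PiE_iff)

lemma walk_at_closed: "x \<in> space iid_sequences \<Longrightarrow> walk_at G x n \<in> carrier G"
  by (induction n) (auto simp: walk_at_Suc iid_space)

lemma walk_at_add: 
  assumes "x \<in> space iid_sequences"
  shows "walk_at G x (k + n) = walk_at G x k \<otimes> walk_at G ((shift_seq ^^ k) x) n"
proof (induction n)
  case 0
  show ?case using walk_at_closed[OF assms] by simp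
next
  case (Suc n)
  then show ?case
    using assms walk_at_closed[OF assms, of k] walk_at_closed[OF walk.funpow_space[OF assms], of k n]
    by (simp add: walk_at_Suc m_assoc iid_space shift_seq_funpow)
qed

text \<open>
  Left invariance: returning to the current site is the same as a return to the identity by the
  walk restarted at the current time.
\<close>

lemma revisit_iff_return:
  assumes "x \<in> space iid_sequences"
  shows "walk_at G x (k + n) = walk_at G x k \<longleftrightarrow> n \<in> returns G ((shift_seq ^^ k) x)"
  using walk_at_closed[OF assms, of k] walk_at_closed[OF walk.funpow_space[OF assms], of k n]
  by (simp add: walk_at_add[OF assms] returns_def r_cancel_one)

lemma walk_at_measurable:
  assumes "{..<n} \<subseteq> I"
  shows "(\<lambda>x. walk_at G x n) \<in> Pi\<^sub>M I (\<lambda>_. M) \<rightarrow>\<^sub>M count_space (carrier G)"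
  using assms
proof (induction n)
  case (Suc n)
  have step: "(\<lambda>x. x n) \<in> Pi\<^sub>M I (\<lambda>_. M) \<rightarrow>\<^sub>M count_space (carrier G)"
    using measurable_component_singleton[of n I "\<lambda>_. M"] Suc.prems
      measurable_cong_sets[OF refl, of M "count_space (carrier G)" "Pi\<^sub>M I (\<lambda>_. M)"] sets_law by auto
  have "(\<lambda>x. walk_at G x n \<otimes> x n) \<in> Pi\<^sub>M I (\<lambda>_. M) \<rightarrow>\<^sub>M count_space (carrier G)"
  proof (rule measurable_compose_countable'[where f = "\<lambda>a x. a \<otimes> x n" and g = "\<lambda>x. walk_at G x n",
        OF _ _ countable_carrier])
    show "(\<lambda>x. walk_at G x n) \<in> Pi\<^sub>M I (\<lambda>_. M) \<rightarrow>\<^sub>M count_space (carrier G)"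
      by (rule Suc.IH) (use Suc.prems in auto)
    fix a assume "a \<in> carrier G"
    then show "(\<lambda>x. a \<otimes> x n) \<in> Pi\<^sub>M I (\<lambda>_. M) \<rightarrow>\<^sub>M count_space (carrier G)"
      by (intro measurable_compose[OF step]) auto
  qed
  then show ?case by (simp add: walk_at_Suc)
qed simp

lemma return_measurable:
  assumes "{..<n} \<subseteq> I"
  shows "Measurable.pred (Pi\<^sub>M I (\<lambda>_. M)) (\<lambda>x. n \<in> returns G x)"
proof -
  have "Measurable.pred (Pi\<^sub>M I (\<lambda>_. M)) (\<lambda>x. walk_at G x n = \<one>)"
    by (rule measurable_compose[OF walk_at_measurable[OF assms]]) simp
  then show ?thesis by (simp add: returns_def)
qed

lemma return_measurable_iid [measurable]: "Measurable.pred iid_sequences (\<lambda>x. n \<in> returns G x)"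
  by (rule return_measurable) simp

lemma walk_at_restrict: "n \<le> k \<Longrightarrow> walk_at G (restrict x {..<k}) n = walk_at G x n"
  by (induction n) (auto simp: walk_at_Suc)

definition escape :: real where
  "escape = measure iid_sequences {x \<in> space iid_sequences. \<forall>n\<ge>1. walk_at G x n \<noteq> \<one>}"

lemma escape_le_1: "escape \<le> 1" "0 \<le> escape"
  unfolding escape_def by (simp_all add: walk.prob_le_1)

text \<open>
  Infinitely many visits exceed every bound; the cardinality alone would count them as \<open>0\<close>.
\<close>

definition visits_exceed :: "nat \<Rightarrow> (nat \<Rightarrow> 'g) set" where
  "visits_exceed j = {x \<in> space iid_sequences. infinite (returns G x) \<or> j < card (returns G x)}"

lemma visits_exceed_measurable [measurable]: "visits_exceed j \<in> sets iid_sequences"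
  unfolding visits_exceed_def by measurable

definition first_return :: "nat \<Rightarrow> (nat \<Rightarrow> 'g) \<Rightarrow> bool" where
  "first_return k x \<longleftrightarrow> k \<ge> 1 \<and> k \<in> returns G x \<and> (\<forall>m\<in>{1..<k}. m \<notin> returns G x)"

text \<open>
  Before the first return time \<open>k\<close> there is exactly one visit, the one at time \<open>0\<close>; all others are visits
  of the restarted walk, moved by \<open>k\<close>.
\<close>

lemma visits_exceed_shift:
  assumes x: "x \<in> space iid_sequences" and k: "first_return k x"
  shows "x \<in> visits_exceed (Suc j) \<longleftrightarrow> (shift_seq ^^ k) x \<in> visits_exceed j"
proof -
  have "returns G x = insert 0 ((+) k ` returns G ((shift_seq ^^ k) x))"
  proof (intro equalityI subsetI)
    fix m assume m: "m \<in> returns G x"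
    show "m \<in> insert 0 ((+) k ` returns G ((shift_seq ^^ k) x))"
    proof (cases "m = 0")
      case False
      then have "k \<le> m" using m k by (force simp: first_return_def)
      then obtain d where d: "m = k + d" using le_Suc_ex by blast
      then have "walk_at G x (k + d) = walk_at G x k"
        using m k by (simp add: first_return_def returns_def)
      then show ?thesis using d revisit_iff_return[OF x] by auto
    qed simp
  next
    fix m assume "m \<in> insert 0 ((+) k ` returns G ((shift_seq ^^ k) x))"
    then consider "m = 0" | d where "m = k + d" "d \<in> returns G ((shift_seq ^^ k) x)" by auto
    then show "m \<in> returns G x"
    proof cases
      case 2
      then show ?thesis using revisit_iff_return[OF x, of k d] k by (simp add: first_return_def returns_def)
    qed simp
  qed
  from card_ge_after_shift[OF this, of j] k show ?thesis
    using x walk.funpow_space[OF x] by (simp add: visits_exceed_def first_return_def)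
qed

lemma first_return_measurable:
  "{..<k} \<subseteq> I \<Longrightarrow> Measurable.pred (Pi\<^sub>M I (\<lambda>_. M)) (first_return k)"
  unfolding first_return_def[abs_def]
  by (intro pred_intros_logic pred_intros_countable_bounded return_measurable) auto

lemma ex_first_return:
  assumes "n \<ge> 1" "n \<in> returns G x" shows "\<exists>k. first_return k x"
proof -
  define k where "k = (LEAST k. k \<ge> 1 \<and> k \<in> returns G x)"
  have "k \<ge> 1 \<and> k \<in> returns G x" unfolding k_def by (rule LeastI[of _ n]) (use assms in auto)
  moreover have "m \<notin> returns G x" if "m \<in> {1..<k}" for m
    using not_less_Least[of m "\<lambda>k. k \<ge> 1 \<and> k \<in> returns G x"] that by (auto simp: k_def)
  ultimately show ?thesis by (auto simp: first_return_def)
qed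

lemma first_return_unique: "first_return k x \<Longrightarrow> first_return l x \<Longrightarrow> k = l"
  by (cases k l rule: linorder_cases) (auto simp: first_return_def)

text \<open>
  Whether the first return happens at time \<open>k\<close> is decided by the first \<open>k\<close> steps, and then the number
  of further visits depends on the later steps only. Summing over \<open>k\<close>, each further visit costs one
  independent factor \<open>1 - escape\<close>, the probability that a first return exists.
\<close>

lemma prob_visits_exceed: "walk.prob (visits_exceed j) = (1 - escape) ^ j"
proof (induction j)
  case 0
  have "visits_exceed 0 = space iid_sequences"
    by (auto simp: visits_exceed_def card_gt_0_iff) (metis empty_iff zero_in_returns)
  then show ?case by (simp add: walk.prob_space)
next
  case (Suc j)
  let ?F = "\<lambda>k. {x \<in> space iid_sequences. first_return k x}"
  let ?E = "\<lambda>k. {x \<in> space iid_sequences. first_return k x \<and> (shift_seq ^^ k) x \<in> visits_exceed j}"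
  have F_sets: "?F k \<in> sets iid_sequences" for k
    using first_return_measurable[of k UNIV] by (simp add: pred_def)
  have E_sets: "?E k \<in> sets iid_sequences" for k
  proof -
    have "?E k = ?F k \<inter> ((shift_seq ^^ k) -` visits_exceed j \<inter> space iid_sequences)" by auto
    then show ?thesis using F_sets measurable_sets[OF walk.funpow_measurable visits_exceed_measurable] by simp
  qed
  have prob_E: "walk.prob (?E k) = walk.prob (?F k) * (1 - escape) ^ j" for k
  proof -
    define A where "A = {y \<in> space (Pi\<^sub>M {..<k} (\<lambda>_. M)). first_return k y}"
    have A: "A \<in> sets (Pi\<^sub>M {..<k} (\<lambda>_. M))"
      using first_return_measurable[of k "{..<k}"] by (simp add: A_def pred_def)
    have iff: "first_return k x \<longleftrightarrow> restrict x {..<k} \<in> A" if "x \<in> space iid_sequences" for x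
      using that by (auto simp: A_def space_PiM first_return_def returns_def walk_at_restrict)
    have "?E k = {x \<in> space iid_sequences. restrict x {..<k} \<in> A \<and> (shift_seq ^^ k) x \<in> visits_exceed j}"
      using iff by blast
    moreover have "?F k = {x \<in> space iid_sequences. restrict x {..<k} \<in> A}" using iff by blast
    ultimately show ?thesis
      using indep_past_future[OF A visits_exceed_measurable, of j] Suc by simp
  qed
  have disj: "disjoint_family ?F" "disjoint_family ?E"
    using first_return_unique by (auto simp: disjoint_family_on_def)
  have "(\<Union>k. ?F k) = space iid_sequences - {x \<in> space iid_sequences. \<forall>n\<ge>1. walk_at G x n \<noteq> \<one>}"
  proof (intro equalityI subsetI)
    fix x assume "x \<in> (\<Union>k. ?F k)"
    then show "x \<in> space iid_sequences - {x \<in> space iid_sequences. \<forall>n\<ge>1. walk_at G x n \<noteq> \<one>}"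
      by (auto simp: first_return_def returns_def)
  next
    fix x assume "x \<in> space iid_sequences - {x \<in> space iid_sequences. \<forall>n\<ge>1. walk_at G x n \<noteq> \<one>}"
    then obtain n where "x \<in> space iid_sequences" "n \<ge> 1" "n \<in> returns G x"
      by (auto simp: returns_def)
    then show "x \<in> (\<Union>k. ?F k)" using ex_first_return by blast
  qed
  moreover have "{x \<in> space iid_sequences. \<forall>n\<ge>1. walk_at G x n \<noteq> \<one>} \<in> sets iid_sequences"
  proof -
    have "{x \<in> space iid_sequences. \<forall>n\<ge>1. n \<notin> returns G x} \<in> sets iid_sequences" by measurable
    then show ?thesis by (simp only: returns_def mem_Collect_eq)
  qed
  ultimately have "walk.prob (\<Union>k. ?F k) = 1 - escape"
    unfolding escape_def by (simp only: walk.prob_compl)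
  moreover have "(\<lambda>k. walk.prob (?F k)) sums walk.prob (\<Union>k. ?F k)"
    by (rule walk.finite_measure_UNION[OF _ disj(1)]) (use F_sets in blast)
  ultimately have "(\<lambda>k. walk.prob (?F k)) sums (1 - escape)" by simp
  then have s1: "(\<lambda>k. walk.prob (?E k)) sums ((1 - escape) * (1 - escape) ^ j)"
    unfolding prob_E by (rule sums_mult2)
  have s2: "(\<lambda>k. walk.prob (?E k)) sums walk.prob (\<Union>k. ?E k)"
    by (rule walk.finite_measure_UNION[OF _ disj(2)]) (use E_sets in blast)
  have eq: "(\<Union>k. ?E k) = visits_exceed (Suc j)"
  proof (intro equalityI subsetI)
    fix x assume "x \<in> (\<Union>k. ?E k)"
    then show "x \<in> visits_exceed (Suc j)" using visits_exceed_shift by blast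
  next
    fix x assume x: "x \<in> visits_exceed (Suc j)"
    then have xs: "x \<in> space iid_sequences" by (simp add: visits_exceed_def)
    have "\<not> returns G x \<subseteq> {0}"
      using x card_mono[of "{0}" "returns G x"] finite_subset[of "returns G x" "{0}"]
      by (auto simp: visits_exceed_def)
    then obtain n where "n \<in> returns G x" "n \<ge> 1" by force
    then obtain k where "first_return k x" using ex_first_return by blast
    then show "x \<in> (\<Union>k. ?E k)" using visits_exceed_shift[OF xs] x xs by blast
  qed
  show ?case using sums_unique2[OF s1 s2] unfolding eq by simp
qed

end

context walk_law begin

definition total_visits :: "(nat \<Rightarrow> 'g) \<Rightarrow> nat" where
  "total_visits x = card (returns G x)"

lemma total_visits_measurable [measurable]: "total_visits \<in> iid_sequences \<rightarrow>\<^sub>M count_space UNIV"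
proof -
  have "{x \<in> space iid_sequences. n \<in> returns G x} \<in> sets iid_sequences" for n
    by (rule predE[OF return_measurable_iid])
  then show ?thesis unfolding total_visits_def[abs_def] by (rule measurable_card)
qed

lemma AE_finite_returns:
  assumes "escape > 0" shows "AE x in iid_sequences. finite (returns G x)"
proof -
  let ?I = "{x \<in> space iid_sequences. infinite (returns G x)}"
  have I_sets: "?I \<in> sets iid_sequences" by measurable
  have "walk.prob ?I \<le> (1 - escape) ^ j" for j
    unfolding prob_visits_exceed[symmetric]
    by (rule walk.finite_measure_mono[OF _ visits_exceed_measurable]) (auto simp: visits_exceed_def)
  moreover have "(\<lambda>j. (1 - escape) ^ j) \<longlonglongrightarrow> 0"
    using assms escape_le_1 by (intro LIMSEQ_power_zero) auto
  ultimately have "walk.prob ?I \<le> 0" by (intro LIMSEQ_le_const) auto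
  then have "walk.prob ?I = 0" by (simp add: measure_le_0_iff)
  then have "?I \<in> null_sets iid_sequences"
    using I_sets by (simp add: null_sets_def walk.emeasure_eq_measure)
  from AE_not_in[OF this] AE_space show ?thesis by eventually_elim auto
qed

lemma prob_total_visits:
  "walk.prob {x \<in> space iid_sequences. total_visits x = Suc j} = escape * (1 - escape) ^ j"
proof -
  have "{x \<in> space iid_sequences. total_visits x = Suc j} = visits_exceed j - visits_exceed (Suc j)"
    by (auto simp: visits_exceed_def total_visits_def intro: card_ge_0_finite)
  moreover have "visits_exceed (Suc j) \<subseteq> visits_exceed j" by (auto simp: visits_exceed_def)
  ultimately have "walk.prob {x \<in> space iid_sequences. total_visits x = Suc j}
      = walk.prob (visits_exceed j) - walk.prob (visits_exceed (Suc j))"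
    by (simp only: walk.finite_measure_Diff[OF visits_exceed_measurable visits_exceed_measurable])
  then show ?thesis by (simp add: prob_visits_exceed algebra_simps)
qed

text \<open>
  The number of visits has the law of one plus a geometric variable. The series of
  contributions of the single values is integrated term by term.
\<close>

lemma expectation_total_visits:
  fixes F :: "nat \<Rightarrow> real"
  assumes esc: "escape > 0" and F: "summable (\<lambda>j. \<bar>F (Suc j)\<bar> * (1 - escape) ^ j)"
  shows "integrable iid_sequences (\<lambda>x. F (total_visits x))"
    and "(\<integral>x. F (total_visits x) \<partial>iid_sequences) = escape * (\<Sum>j. F (Suc j) * (1 - escape) ^ j)"
proof -
  let ?V = "\<lambda>j. {x \<in> space iid_sequences. total_visits x = Suc j}"
  have V: "?V j \<in> sets iid_sequences" for j by measurable
  define f where "f j x = F (Suc j) * indicator (?V j) x" for j x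
  have f_int: "integrable iid_sequences (f j)" for j
    unfolding f_def[abs_def] using V by (intro integrable_mult_right integrable_real_indicator) (simp_all add: walk.emeasure_eq_measure)
  have f_mean: "(\<integral>x. f j x \<partial>iid_sequences) = F (Suc j) * (escape * (1 - escape) ^ j)" for j
    unfolding f_def prob_total_visits[symmetric] using V by simp
  have f_norm: "(\<integral>x. norm (f j x) \<partial>iid_sequences) = \<bar>F (Suc j)\<bar> * (escape * (1 - escape) ^ j)" for j
    unfolding f_def prob_total_visits[symmetric] using V by (simp add: abs_mult)
  have f_single: "(\<lambda>j. f j x) sums F (total_visits x)" "summable (\<lambda>j. norm (f j x))"
    if "finite (returns G x)" "x \<in> space iid_sequences" for x
  proof -
    have "returns G x \<noteq> {}" using zero_in_returns by blast
    then have "total_visits x \<noteq> 0" using that by (simp add: total_visits_def)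
    then obtain k where k: "total_visits x = Suc k" using not0_implies_Suc by blast
    have eq: "f j x = (if j = k then F (total_visits x) else 0)" for j
      using k that by (auto simp: f_def indicator_def)
    then show "(\<lambda>j. f j x) sums F (total_visits x)" using sums_single[of k "\<lambda>_. F (total_visits x)"] by simp
    show "summable (\<lambda>j. norm (f j x))"
      by (rule summable_finite[of "{k}"]) (auto simp: eq)
  qed
  have s1: "AE x in iid_sequences. summable (\<lambda>j. norm (f j x))"
    using AE_finite_returns[OF esc] AE_space by eventually_elim (rule f_single(2))
  have s2: "summable (\<lambda>j. \<integral>x. norm (f j x) \<partial>iid_sequences)"
    unfolding f_norm using summable_mult[OF F, of escape] by (simp add: ac_simps)
  have eq: "AE x in iid_sequences. (\<Sum>j. f j x) = F (total_visits x)"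
    using AE_finite_returns[OF esc] AE_space by eventually_elim (rule sums_unique[OF f_single(1), symmetric])
  have int: "integrable iid_sequences (\<lambda>x. \<Sum>j. f j x)" by (rule integrable_suminf[OF f_int s1 s2])
  have meas: "(\<lambda>x. F (total_visits x)) \<in> borel_measurable iid_sequences"
    by (rule measurable_compose[OF total_visits_measurable]) simp
  show "integrable iid_sequences (\<lambda>x. F (total_visits x))"
    by (rule integrable_cong_AE_imp[OF int meas]) (use eq in \<open>auto elim: eventually_mono\<close>)
  have "(\<integral>x. F (total_visits x) \<partial>iid_sequences) = (\<integral>x. (\<Sum>j. f j x) \<partial>iid_sequences)"
    by (rule integral_cong_AE) (use eq int meas in \<open>auto elim: eventually_mono\<close>)
  also have "\<dots> = (\<Sum>j. F (Suc j) * (escape * (1 - escape) ^ j))"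
    using integral_suminf[OF f_int s1 s2] by (simp only: f_mean)
  also have "\<dots> = (\<Sum>j. escape * (F (Suc j) * (1 - escape) ^ j))" by (simp add: ac_simps)
  also have "\<dots> = escape * (\<Sum>j. F (Suc j) * (1 - escape) ^ j)"
    by (rule suminf_mult) (rule summable_rabs_cancel, use F escape_le_1 in \<open>simp add: abs_mult\<close>)
  finally show "(\<integral>x. F (total_visits x) \<partial>iid_sequences) = escape * (\<Sum>j. F (Suc j) * (1 - escape) ^ j)" .
qed

end

section \<open>Local time sums as sums along the walk\<close>

definition increment :: "(nat \<Rightarrow> real) \<Rightarrow> nat \<Rightarrow> real" where
  "increment f j = f j - f (j - 1)"

definition variation :: "(nat \<Rightarrow> real) \<Rightarrow> nat \<Rightarrow> real" where
  "variation f j = (\<Sum>i\<le>j. \<bar>increment f i\<bar>)"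

lemma variation_nonneg: "0 \<le> variation f j"
  by (simp add: variation_def sum_nonneg)

lemma increment_le_variation: "i \<le> j \<Longrightarrow> \<bar>increment f i\<bar> \<le> variation f j"
  unfolding variation_def by (rule member_le_sum) auto

text \<open>
  Ranked from the largest element down, the elements of \<open>A\<close> have the ranks \<open>1\<close> to \<open>card A\<close>, so the sum
  telescopes.
\<close>

lemma sum_increment_ranks:
  assumes "finite (A :: nat set)" and "f 0 = 0"
  shows "(\<Sum>i\<in>A. increment f (card {j\<in>A. i \<le> j})) = f (card A)"
  using assms(1)
proof (induction A rule: finite_linorder_min_induct)
  case empty
  show ?case using assms(2) by simp
next
  case (insert b A)
  have "b \<notin> A" using insert.hyps by auto
  have "{j \<in> insert b A. b \<le> j} = insert b A" using insert.hyps by auto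
  moreover have "{j \<in> insert b A. i \<le> j} = {j \<in> A. i \<le> j}" if "i \<in> A" for i
    using insert.hyps that by auto
  ultimately have "(\<Sum>i\<in>insert b A. increment f (card {j\<in>insert b A. i \<le> j}))
      = increment f (card (insert b A)) + (\<Sum>i\<in>A. increment f (card {j\<in>A. i \<le> j}))"
    using insert.hyps \<open>b \<notin> A\<close> by simp
  also have "\<dots> = f (card (insert b A))"
    using insert \<open>b \<notin> A\<close> by (simp add: increment_def)
  finally show ?case .
qed

text \<open>
  The ranks are applied to the visit times of each site. A visit at time \<open>i\<close> is ranked by the
  number of visits not before it, so that its term depends only on what happens from time \<open>i\<close> on.
\<close>

lemma local_time_sum_increments:
  assumes S: "\<And>i. S i \<omega> \<in> carrier G" and f: "f 0 = 0" and n: "n \<ge> 1"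
  shows "local_time_sum G S f n \<omega> = (\<Sum>i<n. increment f (card {j. i \<le> j \<and> j < n \<and> S j \<omega> = S i \<omega>}))"
proof -
  let ?A = "\<lambda>x. {i \<in> {..<n}. S i \<omega> = x}"
  have lt: "local_time S (n - 1) x \<omega> = card (?A x)" for x
  proof -
    have "{0..n - 1} = {..<n}" using n by auto
    then have "local_time S (n - 1) x \<omega> = (\<Sum>i<n. of_bool (S i \<omega> = x))" by (simp add: local_time_def)
    then show ?thesis by (simp add: Int_def)
  qed
  let ?V = "(\<lambda>i. S i \<omega>) ` {..<n}"
  have "local_time_sum G S f n \<omega> = (\<Sum>\<^sub>\<infinity>x\<in>carrier G. f (card (?A x)))"
    by (simp only: local_time_sum_def lt)
  also have "\<dots> = (\<Sum>\<^sub>\<infinity>x\<in>?V. f (card (?A x)))"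
  proof (rule infsum_cong_neutral)
    fix x assume "x \<in> carrier G - ?V"
    then have "?A x = {}" by auto
    then show "f (card (?A x)) = 0" using f by (simp only: card.empty)
  qed (use S in auto)
  also have "\<dots> = (\<Sum>x\<in>?V. f (card (?A x)))" by simp
  also have "\<dots> = (\<Sum>x\<in>?V. \<Sum>i\<in>?A x. increment f (card {j. i \<le> j \<and> j < n \<and> S j \<omega> = S i \<omega>}))"
  proof (rule sum.cong[OF refl])
    fix x
    have "f (card (?A x)) = (\<Sum>i\<in>?A x. increment f (card {j\<in>?A x. i \<le> j}))"
      by (rule sum_increment_ranks[symmetric]) (use f in auto)
    also have "\<dots> = (\<Sum>i\<in>?A x. increment f (card {j. i \<le> j \<and> j < n \<and> S j \<omega> = S i \<omega>}))"
      by (intro sum.cong refl arg_cong[where f = "\<lambda>B. increment f (card B)"]) auto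
    finally show "f (card (?A x)) = \<dots>" .
  qed
  also have "\<dots> = (\<Sum>i<n. increment f (card {j. i \<le> j \<and> j < n \<and> S j \<omega> = S i \<omega>}))"
    by (rule sum.image_gen[symmetric]) simp
  finally show ?thesis .
qed

text \<open>
  The variation is at most twice a partial sum of \<open>\<bar>f\<bar>\<close>. The partial sums, weighted by \<open>q ^ j\<close>, are the Cauchy
  product of the given series with the geometric series.
\<close>

lemma summable_variation:
  fixes q :: real
  assumes q: "0 \<le> q" "q < 1" and f: "f 0 = 0" and s: "summable (\<lambda>j. \<bar>f (Suc j)\<bar> * q ^ j)"
  shows "summable (\<lambda>j. variation f (Suc j) * q ^ j)"
proof -
  \<comment> \<open>the extra term \<open>\<bar>f (Suc j)\<bar>\<close> makes the induction work: it pays for its own part of the next increment\<close>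
  have strong: "variation f (Suc j) + \<bar>f (Suc j)\<bar> \<le> 2 * (\<Sum>i\<le>j. \<bar>f (Suc i)\<bar>)" for j
  proof (induction j)
    case 0
    show ?case by (simp add: variation_def increment_def f)
  next
    case (Suc j)
    have "variation f (Suc (Suc j)) = variation f (Suc j) + \<bar>f (Suc (Suc j)) - f (Suc j)\<bar>"
      by (simp add: variation_def increment_def)
    moreover have "(\<Sum>i\<le>Suc j. \<bar>f (Suc i)\<bar>) = (\<Sum>i\<le>j. \<bar>f (Suc i)\<bar>) + \<bar>f (Suc (Suc j))\<bar>"
      by simp
    ultimately show ?case
      using Suc abs_triangle_ineq4[of "f (Suc (Suc j))" "f (Suc j)"] by linarith
  qed
  have bound: "variation f (Suc j) \<le> 2 * (\<Sum>i\<le>j. \<bar>f (Suc i)\<bar>)" for j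
    using strong[of j] by linarith
  have "summable (\<lambda>j. \<Sum>i\<le>j. (\<bar>f (Suc i)\<bar> * q ^ i) * q ^ (j - i))"
    by (rule summable_Cauchy_product) (use s q in \<open>auto intro: summable_geometric simp: abs_mult\<close>)
  moreover have "(\<Sum>i\<le>j. (\<bar>f (Suc i)\<bar> * q ^ i) * q ^ (j - i)) = (\<Sum>i\<le>j. \<bar>f (Suc i)\<bar>) * q ^ j" for j
    by (simp add: sum_distrib_right mult.assoc power_add[symmetric])
  ultimately have "summable (\<lambda>j. 2 * ((\<Sum>i\<le>j. \<bar>f (Suc i)\<bar>) * q ^ j))" by (simp add: summable_mult)
  then show ?thesis
  proof (rule summable_comparison_test'[where N = 0])
    fix j
    show "norm (variation f (Suc j) * q ^ j) \<le> 2 * ((\<Sum>i\<le>j. \<bar>f (Suc i)\<bar>) * q ^ j)"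
      using mult_right_mono[OF bound[of j], of "q ^ j"] q variation_nonneg[of f "Suc j"] by (simp add: abs_mult)
  qed
qed

lemma suminf_increment:
  fixes q :: real
  assumes q: "0 \<le> q" "q < 1" and f: "f 0 = 0" and s: "summable (\<lambda>j. \<bar>f (Suc j)\<bar> * q ^ j)"
  shows "(\<Sum>j. increment f (Suc j) * q ^ j) = (1 - q) * (\<Sum>j. f (Suc j) * q ^ j)"
proof -
  have s1: "summable (\<lambda>j. f (Suc j) * q ^ j)"
    by (rule summable_rabs_cancel) (use s q in \<open>simp add: abs_mult\<close>)
  have s2: "summable (\<lambda>j. f (Suc j) * q ^ Suc j)"
    using summable_mult[OF s1, of q] by (simp add: ac_simps)
  have s3: "summable (\<lambda>j. f j * q ^ j)"
    using s2 by (subst summable_Suc_iff[symmetric])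
  have "(\<Sum>j. f j * q ^ j) = (\<Sum>j. f (Suc j) * q ^ Suc j)"
    using suminf_split_head[OF s3] f by simp
  also have "\<dots> = q * (\<Sum>j. f (Suc j) * q ^ j)"
    using suminf_mult[OF s1, of q] by (simp add: ac_simps)
  finally have "(\<Sum>j. f j * q ^ j) = q * (\<Sum>j. f (Suc j) * q ^ j)" .
  moreover have "(\<Sum>j. increment f (Suc j) * q ^ j) = (\<Sum>j. f (Suc j) * q ^ j) - (\<Sum>j. f j * q ^ j)"
    using suminf_diff[OF s1 s3] by (simp add: increment_def left_diff_distrib)
  ultimately show ?thesis by (simp add: left_diff_distrib)
qed

context walk_law begin

section \<open>The strong law for local time sums\<close>

text \<open>
  The sum of \<open>local_time_sum_increments\<close> for the walk with step sequence \<open>x\<close>, with the visits to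
  the site occupied at time \<open>i\<close> expressed as returns of the restarted walk.
\<close>

definition walk_functional :: "(nat \<Rightarrow> real) \<Rightarrow> nat \<Rightarrow> (nat \<Rightarrow> 'g) \<Rightarrow> real" where
  "walk_functional f n x = (\<Sum>i<n. increment f (card {k \<in> returns G ((shift_seq ^^ i) x). k < n - i}))"

lemma walk_functional_measurable [measurable]: "walk_functional f n \<in> borel_measurable iid_sequences"
proof -
  have card: "(\<lambda>y. card {k \<in> returns G y. k < m}) \<in> iid_sequences \<rightarrow>\<^sub>M count_space UNIV" for m
  proof (rule measurable_card)
    fix k
    have "Measurable.pred iid_sequences (\<lambda>y. k \<in> returns G y \<and> k < m)" by measurable
    from predE[OF this] show "{y \<in> space iid_sequences. k \<in> {k \<in> returns G y. k < m}} \<in> sets iid_sequences"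
      by simp
  qed
  have "(\<lambda>y. increment f (card {k \<in> returns G y. k < m})) \<in> borel_measurable iid_sequences" for m
    by (rule measurable_compose[OF card]) simp
  then show ?thesis
    unfolding walk_functional_def[abs_def]
    by (intro borel_measurable_sum measurable_compose[OF walk.funpow_measurable])
qed

text \<open>
  The finite windows are replaced by the whole future, which costs at most \<open>u (n - i)\<close> at index \<open>i\<close>. The
  factor \<open>2\<close> in \<open>u\<close> accounts for the term with the finite window and the one with the infinite
  window; both are bounded by \<open>h\<close> because the variation is nondecreasing.
\<close>

theorem walk_functional_limit:
  assumes esc: "escape > 0" and f0: "f 0 = 0"
    and f: "summable (\<lambda>j. \<bar>f (Suc j)\<bar> * (1 - escape) ^ j)"
    and c: "c = escape\<^sup>2 * (\<Sum>j. f (Suc j) * (1 - escape) ^ j)"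
  shows "AE x in iid_sequences. (\<lambda>n. walk_functional f n x / n) \<longlonglongrightarrow> c"
    and "(\<lambda>n. \<integral>x. \<bar>walk_functional f n x / n - c\<bar> \<partial>iid_sequences) \<longlonglongrightarrow> 0"
proof -
  let ?q = "1 - escape"
  have q: "0 \<le> ?q" "?q < 1" using esc escape_le_1 by auto
  define g where "g x = increment f (total_visits x)" for x
  define h where "h x = variation f (total_visits x)" for x
  define late where "late m x \<longleftrightarrow> (\<exists>k\<ge>m. k \<in> returns G x)" for m x
  define u where "u m x = 2 * h x * of_bool (late m x)" for m x
  have summable_h: "summable (\<lambda>j. \<bar>variation f (Suc j)\<bar> * ?q ^ j)"
    using summable_variation[of ?q f] q f0 f by (simp add: variation_nonneg)
  have summable_g: "summable (\<lambda>j. \<bar>increment f (Suc j)\<bar> * ?q ^ j)"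
  proof (rule summable_comparison_test'[OF summable_h, where N = 0])
    fix j
    show "norm (\<bar>increment f (Suc j)\<bar> * ?q ^ j) \<le> \<bar>variation f (Suc j)\<bar> * ?q ^ j"
      using increment_le_variation[of "Suc j" "Suc j" f] variation_nonneg[of f "Suc j"] q
      by (simp add: abs_mult mult_right_mono)
  qed
  have h_int: "integrable iid_sequences h"
    unfolding h_def[abs_def] by (rule expectation_total_visits(1)[OF esc summable_h])
  have g_int: "integrable iid_sequences g"
    unfolding g_def[abs_def] by (rule expectation_total_visits(1)[OF esc summable_g])
  have g_mean: "(\<integral>x. g x \<partial>iid_sequences) = c"
    unfolding g_def expectation_total_visits(2)[OF esc summable_g]
    using suminf_increment[of ?q f] q f0 f c by (simp add: power2_eq_square)
  have h_nonneg: "0 \<le> h x" for x by (simp add: h_def variation_nonneg)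
  have late_meas: "Measurable.pred iid_sequences (late m)" for m
    unfolding late_def[abs_def] by measurable
  have u_meas: "u m \<in> borel_measurable iid_sequences" for m
    unfolding u_def[abs_def] using late_meas h_int by measurable
  have u_int: "integrable iid_sequences (u 0)"
    by (rule Bochner_Integration.integrable_bound[of _ "\<lambda>x. 2 * h x"])
      (use h_int u_meas h_nonneg in \<open>auto simp: u_def\<close>)
  have u_nonneg: "0 \<le> u m x" for m x by (simp add: u_def h_nonneg)
  have u_dec: "decseq (\<lambda>m. u m x)" for x
    unfolding decseq_def u_def late_def by (auto simp: h_nonneg)
  have u_lim: "AE x in iid_sequences. (\<lambda>m. u m x) \<longlonglongrightarrow> 0"
    using AE_finite_returns[OF esc]
  proof eventually_elim
    case (elim x)
    then obtain b where "\<forall>k\<in>returns G x. k < b" using finite_nat_set_iff_bounded by blast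
    then have "\<forall>m\<ge>b. u m x = 0" by (auto simp: u_def late_def)
    then show ?case by (intro tendsto_eventually) (auto simp: eventually_sequentially)
  qed
  have orbit: "AE x in iid_sequences. \<forall>i. finite (returns G ((shift_seq ^^ i) x))"
    by (rule walk.AE_orbit[OF AE_finite_returns[OF esc]])
  have inc_le: "\<bar>increment f (card {k \<in> returns G y. k < m})\<bar> \<le> h y" if "finite (returns G y)" for y m
    unfolding h_def total_visits_def
    by (intro increment_le_variation card_mono) (use that in auto)
  have error: "\<bar>increment f (card {k \<in> returns G y. k < m}) - g y\<bar> \<le> u m y"
    if "finite (returns G y)" for y m
  proof (cases "late m y")
    case True
    have "\<bar>g y\<bar> \<le> h y" unfolding g_def h_def by (rule increment_le_variation) simp
    with inc_le[OF that, of m] True show ?thesis by (simp add: u_def)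
  next
    case False
    then have "{k \<in> returns G y. k < m} = returns G y" by (auto simp: late_def not_le)
    then show ?thesis using False by (simp add: u_def g_def total_visits_def)
  qed
  show lim: "AE x in iid_sequences. (\<lambda>n. walk_functional f n x / n) \<longlonglongrightarrow> c"
    using walk.birkhoff_ergodic[OF g_int]
      walk.birkhoff_delayed_vanishing[where u = u, OF u_int u_meas u_nonneg u_dec u_lim] orbit
  proof eventually_elim
    case (elim x)
    have "(\<lambda>n. (walk_functional f n x - birkhoff_sum shift_seq g n x) / n) \<longlonglongrightarrow> 0"
    proof (rule Lim_null_comparison[OF _ elim(2)], intro always_eventually allI)
      fix n
      have "\<bar>walk_functional f n x - birkhoff_sum shift_seq g n x\<bar> \<le> (\<Sum>i<n. u (n - i) ((shift_seq ^^ i) x))"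
        unfolding walk_functional_def birkhoff_sum_def sum_subtractf[symmetric]
        by (rule order_trans[OF sum_abs]) (intro sum_mono error, use elim(3) in simp)
      then show "norm ((walk_functional f n x - birkhoff_sum shift_seq g n x) / n)
          \<le> (\<Sum>i<n. u (n - i) ((shift_seq ^^ i) x)) / n"
        by (simp add: divide_right_mono)
    qed
    from tendsto_add[OF this elim(1)] show ?case
      by (simp add: g_mean diff_divide_distrib)
  qed
  show "(\<lambda>n. \<integral>x. \<bar>walk_functional f n x / n - c\<bar> \<partial>iid_sequences) \<longlonglongrightarrow> 0"
  proof (rule walk.L1_convergence_of_dominated)
    show "integrable iid_sequences (\<lambda>x. h x + \<bar>c\<bar>)" using h_int by simp
    show "(\<lambda>x. walk_functional f n x / n - c) \<in> borel_measurable iid_sequences" for n by measurable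
    show "AE x in iid_sequences. (\<lambda>n. walk_functional f n x / n - c) \<longlonglongrightarrow> 0"
      using lim by eventually_elim (simp add: LIM_zero)
    fix n :: nat assume n: "n \<ge> 1"
    show "AE x in iid_sequences. \<bar>walk_functional f n x / n - c\<bar>
        \<le> birkhoff_sum shift_seq (\<lambda>x. h x + \<bar>c\<bar>) n x / n"
      using orbit
    proof eventually_elim
      case (elim x)
      have "\<bar>walk_functional f n x\<bar> \<le> (\<Sum>i<n. h ((shift_seq ^^ i) x))"
        unfolding walk_functional_def
        by (rule order_trans[OF sum_abs]) (intro sum_mono inc_le, use elim in simp)
      then have "\<bar>walk_functional f n x\<bar> / n + \<bar>c\<bar> \<le> birkhoff_sum shift_seq (\<lambda>x. h x + \<bar>c\<bar>) n x / n"
        using n by (simp add: birkhoff_sum_def sum.distrib add_divide_distrib divide_right_mono)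
      moreover have "\<bar>walk_functional f n x / n - c\<bar> \<le> \<bar>walk_functional f n x\<bar> / n + \<bar>c\<bar>"
        using abs_triangle_ineq4[of "walk_functional f n x / n" c] by (simp add: abs_divide)
      ultimately show ?case by linarith
    qed
  qed
qed

end

section \<open>Transfer to an arbitrary probability space\<close>

context random_walk
begin

definition step_law :: "'g measure" where
  "step_law = distr M (count_space (carrier G)) (\<xi> 1)"

definition steps :: "'w \<Rightarrow> nat \<Rightarrow> 'g" where
  "steps \<omega> i = \<xi> (Suc i) \<omega>"

lemma step_measurable: "n \<ge> 1 \<Longrightarrow> \<xi> n \<in> M \<rightarrow>\<^sub>M count_space (carrier G)"
  using indep_steps by (auto simp: indep_vars_def)

sublocale law: walk_law step_law G
proof (intro walk_law.intro walk_law_axioms.intro)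
  show "prob_space step_law"
    unfolding step_law_def by (rule prob_space_distr) (rule step_measurable, simp)
qed (auto simp: step_law_def countable_carrier is_group)

text \<open>
  Independence and equal distribution of the steps say that the joint law of the steps is a product
  measure; it remains to renumber them from \<open>0\<close>. The almost sure and \<open>L\<^sup>1\<close> statements
  can therefore be proved on the space of step sequences.
\<close>

lemma distr_steps: "distr M law.iid_sequences steps = law.iid_sequences"
  and steps_measurable: "steps \<in> M \<rightarrow>\<^sub>M law.iid_sequences"
proof -
  let ?C = "\<lambda>_. count_space (carrier G)"
  let ?P = "Pi\<^sub>M {1::nat..} (\<lambda>_. step_law)"
  have step_m: "\<xi> n \<in> M \<rightarrow>\<^sub>M step_law" if "n \<ge> 1" for n
    using step_measurable[OF that] by (simp add: step_law_def)
  have sets: "sets ?P = sets (Pi\<^sub>M {1::nat..} ?C)" by (intro sets_PiM_cong) (auto simp: step_law_def)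
  have "distr M (Pi\<^sub>M {1..} ?C) (\<lambda>\<omega>. \<lambda>i\<in>{1..}. \<xi> i \<omega>) = Pi\<^sub>M {1..} (\<lambda>i. distr M (?C i) (\<xi> i))"
    using indep_steps by (subst (asm) indep_vars_iff_distr_eq_PiM') (auto intro: step_measurable)
  also have "\<dots> = ?P" unfolding step_law_def by (rule PiM_cong[OF refl], rule ident_steps) simp
  also have "distr M (Pi\<^sub>M {1..} ?C) (\<lambda>\<omega>. \<lambda>i\<in>{1..}. \<xi> i \<omega>) = distr M ?P (\<lambda>\<omega>. \<lambda>i\<in>{1..}. \<xi> i \<omega>)"
    by (rule distr_cong[OF refl sets[symmetric] refl])
  finally have joint: "distr M ?P (\<lambda>\<omega>. \<lambda>i\<in>{1..}. \<xi> i \<omega>) = ?P" .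
  have m1: "(\<lambda>\<omega>. \<lambda>i\<in>{1..}. \<xi> i \<omega>) \<in> M \<rightarrow>\<^sub>M ?P"
    by (rule measurable_restrict) (rule step_m, simp)
  have m2: "(\<lambda>x. \<lambda>i\<in>UNIV. x (Suc i)) \<in> ?P \<rightarrow>\<^sub>M law.iid_sequences"
    by (rule measurable_restrict) simp
  have comp: "(\<lambda>x. \<lambda>i\<in>UNIV. x (Suc i)) \<circ> (\<lambda>\<omega>. \<lambda>i\<in>{1..}. \<xi> i \<omega>) = steps"
    by (auto simp: steps_def fun_eq_iff)
  show "steps \<in> M \<rightarrow>\<^sub>M law.iid_sequences"
    using measurable_comp[OF m1 m2] unfolding comp .
  have "distr ?P law.iid_sequences (\<lambda>x. \<lambda>i\<in>UNIV. x (Suc i)) = law.iid_sequences"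
    by (rule distr_PiM_reindex) (auto simp: law.prob_space_axioms)
  then show "distr M law.iid_sequences steps = law.iid_sequences"
    using distr_distr[OF m2 m1] unfolding joint comp by (rule trans[OF sym, rotated])
qed

lemma walk_eq_walk_at: "n \<ge> 1 \<Longrightarrow> \<omega> \<in> space M \<Longrightarrow> S n \<omega> = walk_at G (steps \<omega>) n"
proof -
  assume n: "n \<ge> 1" "\<omega> \<in> space M"
  have "oprod G (\<lambda>i. \<xi> i \<omega>) n = walk_at G (steps \<omega>) n" for n
    by (induction n) (simp_all add: walk_at_Suc steps_def)
  then show ?thesis using walk[OF n] by simp
qed

lemma walk_measurable: "S n \<in> M \<rightarrow>\<^sub>M count_space (carrier G)"
proof (cases "n = 0")
  case False
  have "(\<lambda>\<omega>. walk_at G (steps \<omega>) n) \<in> M \<rightarrow>\<^sub>M count_space (carrier G)"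
    by (rule measurable_compose[OF steps_measurable law.walk_at_measurable]) simp
  then show ?thesis using False walk_eq_walk_at by (subst measurable_cong[where g = "\<lambda>\<omega>. walk_at G (steps \<omega>) n"]) auto
qed (use walk_0_measurable in simp)

lemma escape_prob_eq: "escape_prob M G S = law.escape"
proof -
  let ?N = "{x \<in> space law.iid_sequences. \<forall>n\<ge>1. walk_at G x n \<noteq> \<one>\<^bsub>G\<^esub>}"
  have N: "?N \<in> sets law.iid_sequences"
  proof -
    have "{x \<in> space law.iid_sequences. \<forall>n\<ge>1. n \<notin> returns G x} \<in> sets law.iid_sequences" by measurable
    then show ?thesis by (simp only: returns_def mem_Collect_eq)
  qed
  have "law.escape = measure (distr M law.iid_sequences steps) ?N"
    unfolding law.escape_def distr_steps ..
  also have "\<dots> = prob (steps -` ?N \<inter> space M)"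
    by (rule measure_distr[OF steps_measurable N])
  also have "steps -` ?N \<inter> space M = {\<omega> \<in> space M. \<forall>n\<ge>1. S n \<omega> \<noteq> \<one>\<^bsub>G\<^esub>}"
    using measurable_space[OF steps_measurable] walk_eq_walk_at by auto
  finally show ?thesis by (simp add: escape_prob_def)
qed

lemma local_time_sum_walk:
  assumes "\<omega> \<in> space M" "S 0 \<omega> = \<one>\<^bsub>G\<^esub>" "f 0 = 0" "n \<ge> 1"
  shows "local_time_sum G S f n \<omega> = law.walk_functional f n (steps \<omega>)"
proof -
  have steps: "steps \<omega> \<in> space law.iid_sequences" by (rule measurable_space[OF steps_measurable assms(1)])
  have S: "S i \<omega> = walk_at G (steps \<omega>) i" for i
    using assms walk_eq_walk_at[of i \<omega>] by (cases "i = 0") auto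
  have "card {j. i \<le> j \<and> j < n \<and> S j \<omega> = S i \<omega>}
      = card {k \<in> returns G ((shift_seq ^^ i) (steps \<omega>)). k < n - i}" for i
  proof -
    have "{j. i \<le> j \<and> j < n \<and> S j \<omega> = S i \<omega>}
        = (+) i ` {k \<in> returns G ((shift_seq ^^ i) (steps \<omega>)). k < n - i}"
    proof (intro equalityI subsetI)
      fix j assume j: "j \<in> {j. i \<le> j \<and> j < n \<and> S j \<omega> = S i \<omega>}"
      then have "j = i + (j - i)" by simp
      moreover have "j - i \<in> returns G ((shift_seq ^^ i) (steps \<omega>))"
        using j law.revisit_iff_return[OF steps, of i "j - i"] by (simp add: S)
      ultimately show "j \<in> (+) i ` {k \<in> returns G ((shift_seq ^^ i) (steps \<omega>)). k < n - i}"
        using j by (intro image_eqI[of _ _ "j - i"]) auto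
    qed (use law.revisit_iff_return[OF steps, of i] S in auto)
    then show ?thesis by (simp add: card_image)
  qed
  then show ?thesis
    using local_time_sum_increments[of S \<omega> G f n] assms measurable_space[OF walk_measurable]
    by (simp add: law.walk_functional_def)
qed

text \<open>
  For fixed \<open>n\<close> the sum is bounded, since no local time exceeds \<open>n\<close>. Rewriting it as a finite sum over
  times also gives measurability on all of \<open>M\<close>, including the null set where the walk does not
  start at the identity.
\<close>

lemma integrable_local_time_sum:
  assumes f: "f 0 = 0" and n: "n \<ge> 1"
  shows "integrable M (local_time_sum G S f n)"
proof -
  let ?V = "\<lambda>i \<omega>. {j. i \<le> j \<and> j < n \<and> S j \<omega> = S i \<omega>}"
  have S: "S i \<omega> \<in> carrier G" if "\<omega> \<in> space M" for i \<omega>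
    using measurable_space[OF walk_measurable that] by simp
  have card_meas: "(\<lambda>\<omega>. card (?V i \<omega>)) \<in> M \<rightarrow>\<^sub>M count_space UNIV" for i
  proof (rule measurable_card)
    fix j
    have "Measurable.pred M (\<lambda>\<omega>. S j \<omega> = S i \<omega>)"
    proof (rule measurable_compose_countable'[where f = "\<lambda>a \<omega>. S j \<omega> = a" and g = "S i", OF _ walk_measurable countable_carrier])
      show "Measurable.pred M (\<lambda>\<omega>. S j \<omega> = a)" for a
        by (rule measurable_compose[OF walk_measurable]) simp
    qed
    then have "Measurable.pred M (\<lambda>\<omega>. i \<le> j \<and> j < n \<and> S j \<omega> = S i \<omega>)" by measurable
    from predE[OF this] show "{\<omega> \<in> space M. j \<in> ?V i \<omega>} \<in> sets M"
      by (simp only: mem_Collect_eq)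
  qed
  have "integrable M (\<lambda>\<omega>. increment f (card (?V i \<omega>)))" for i
  proof (rule integrable_const_bound[where B = "variation f n"])
    have "card (?V i \<omega>) \<le> n" for \<omega> using card_mono[of "{..<n}" "?V i \<omega>"] by auto
    then show "AE \<omega> in M. norm (increment f (card (?V i \<omega>))) \<le> variation f n"
      by (simp add: increment_le_variation)
    show "(\<lambda>\<omega>. increment f (card (?V i \<omega>))) \<in> borel_measurable M"
      by (rule measurable_compose[OF card_meas]) simp
  qed
  then have "integrable M (\<lambda>\<omega>. \<Sum>i<n. increment f (card (?V i \<omega>)))" by simp
  then show ?thesis
    using local_time_sum_increments[of S _ G f n, OF S f n] by (subst Bochner_Integration.integrable_cong[OF refl]) auto
qed

end

theorem theorem1:
  fixes M :: "'w measure" and G :: "('g, 'b) monoid_scheme"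
    and \<xi> S :: "nat \<Rightarrow> 'w \<Rightarrow> 'g"
    and f :: "nat \<Rightarrow> real" and \<gamma> c :: real
  assumes "random_walk M G \<xi> S"
    and "transient M G S"
    and "\<gamma> = escape_prob M G S"
    and "f 0 = 0"
    and "summable (\<lambda>j. \<bar>f (Suc j)\<bar> * (1 - \<gamma>) ^ Suc j)"
    and "c = \<gamma>\<^sup>2 * (\<Sum>j. f (Suc j) * (1 - \<gamma>) ^ j)"
  shows "(\<forall>n\<ge>1. integrable M (\<lambda>\<omega>. 1 / real n * local_time_sum G S f n \<omega>)) \<and>
    (\<lambda>n. \<integral>\<omega>. \<bar>1 / real n * local_time_sum G S f n \<omega> - c\<bar> \<partial>M) \<longlonglongrightarrow> 0 \<and>
    (AE \<omega> in M. (\<lambda>n. 1 / real n * local_time_sum G S f n \<omega>) \<longlonglongrightarrow> c)"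
proof -
  interpret random_walk M G \<xi> S by (rule assms(1))
  have \<gamma>: "\<gamma> = law.escape" using assms(3) escape_prob_eq by simp
  have esc: "law.escape > 0" using assms(2,3) \<gamma> by (simp add: transient_def)
  have s: "summable (\<lambda>j. \<bar>f (Suc j)\<bar> * (1 - law.escape) ^ j)"
  \<comment> \<open>the hypothesis has one power of \<open>1 - escape\<close> more; if that number is \<open>0\<close>, it cannot be cancelled, but only the term \<open>j = 0\<close> remains\<close>
  proof (cases "law.escape = 1")
    case True
    show ?thesis by (rule summable_finite[of "{0}"]) (auto simp: True)
  next
    case False
    have "summable (\<lambda>j. (1 - law.escape) * (\<bar>f (Suc j)\<bar> * (1 - law.escape) ^ j))"
      using assms(5) by (simp add: \<gamma> ac_simps)
    then show ?thesis using False by (subst (asm) summable_cmult_iff) simp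
  qed
  note lim = law.walk_functional_limit[OF esc assms(4) s assms(6)[unfolded \<gamma>]]
  have eq: "AE \<omega> in M. \<forall>n\<ge>1. 1 / real n * local_time_sum G S f n \<omega> = law.walk_functional f n (steps \<omega>) / n"
    using walk_0 AE_space by eventually_elim (simp add: local_time_sum_walk assms(4))
  have "AE \<omega> in M. (\<lambda>n. law.walk_functional f n (steps \<omega>) / n) \<longlonglongrightarrow> c"
    by (rule AE_distrD[OF steps_measurable]) (simp only: distr_steps lim(1))
  with eq have as: "AE \<omega> in M. (\<lambda>n. 1 / real n * local_time_sum G S f n \<omega>) \<longlonglongrightarrow> c"
  proof eventually_elim
    case (elim \<omega>)
    show ?case
      by (rule Lim_transform_eventually[OF elim(2)])
        (use elim(1) in \<open>auto simp: eventually_sequentially intro!: exI[of _ 1]\<close>)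
  qed
  have int: "integrable M (\<lambda>\<omega>. 1 / real n * local_time_sum G S f n \<omega>)" if "n \<ge> 1" for n
    using integrable_local_time_sum[of f n, OF assms(4) that] by simp
  have "(\<integral>\<omega>. \<bar>1 / real n * local_time_sum G S f n \<omega> - c\<bar> \<partial>M)
      = (\<integral>x. \<bar>law.walk_functional f n x / n - c\<bar> \<partial>law.iid_sequences)" if n: "n \<ge> 1" for n
  proof -
    have meas: "(\<lambda>x. \<bar>law.walk_functional f n x / n - c\<bar>) \<in> borel_measurable law.iid_sequences"
      by measurable
    have "(\<integral>\<omega>. \<bar>1 / real n * local_time_sum G S f n \<omega> - c\<bar> \<partial>M)
        = (\<integral>\<omega>. \<bar>law.walk_functional f n (steps \<omega>) / n - c\<bar> \<partial>M)"
    proof (rule integral_cong_AE)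
      show "AE \<omega> in M. \<bar>1 / real n * local_time_sum G S f n \<omega> - c\<bar> = \<bar>law.walk_functional f n (steps \<omega>) / n - c\<bar>"
        using eq by eventually_elim (use n in simp)
      show "(\<lambda>\<omega>. \<bar>1 / real n * local_time_sum G S f n \<omega> - c\<bar>) \<in> borel_measurable M"
        using int[OF n] by measurable
    qed (rule measurable_compose[OF steps_measurable meas])
    also have "\<dots> = (\<integral>x. \<bar>law.walk_functional f n x / n - c\<bar> \<partial>distr M law.iid_sequences steps)"
      by (rule integral_distr[OF steps_measurable meas, symmetric])
    finally show ?thesis unfolding distr_steps .
  qed
  then have "\<forall>\<^sub>F n in sequentially. (\<integral>x. \<bar>law.walk_functional f n x / n - c\<bar> \<partial>law.iid_sequences)
      = (\<integral>\<omega>. \<bar>1 / real n * local_time_sum G S f n \<omega> - c\<bar> \<partial>M)"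
    by (auto simp: eventually_sequentially intro!: exI[of _ 1])
  with lim(2) have "(\<lambda>n. \<integral>\<omega>. \<bar>1 / real n * local_time_sum G S f n \<omega> - c\<bar> \<partial>M) \<longlonglongrightarrow> 0"
    by (rule Lim_transform_eventually)
  with int as show ?thesis by blast
qed

end
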